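(* Let $d\ge 1$, let $\Gamma\subset\mathbb{R}^d$ be a countable set, and let $r>0$ be such that every point of $\mathbb{R}^d$ is within $\|\cdot\|_\infty$-distance at most $r$ of some point of $\Gamma$. Let $\mathcal{H}$ be a separable Hilbert space and let $H$ be a bounded self-adjoint operator on $\ell^2(\Gamma;\mathcal{H})$. Let $\epsilon>0$ and $\lambda\in\mathbb{R}$. If there is some $L>0$ such that $H$ is $\epsilon$-bulk-gapped at energy $\lambda$ and scale $L$ (with respect to $r$), then $$\sigma(H)\cap(\lambda-\epsilon,\lambda+\epsilon)=\varnothing ,$$ where $\sigma(H)$ denotes the spectrum of $H$.
   Context: Distances in $\mathbb{R}^d$ are measured with $\|x\|_\infty=\max\{|x_1|,\dots,|x_d|\}$. For $x\in\mathbb{R}^d$ and $\rho>0$, $B_\rho(x)=\prod_{j=1}^d(x_j-\rho,x_j+\rho)$ is the open cube of side length $2\rho$ centered at $x$, and $\overline{B_\rho}(x)$ is its closure. For $A\subset\mathbb{R}^d$ and $\psi\in\ell^2(\Gamma;\mathcal{H})$, $\|\psi\|_A^2:=\sum_{x\in\Gamma\cap A}\|\psi(x)\|_{\mathcal{H}}^2$. Definition. Let $\epsilon,L>0$ and $\lambda\in\mathbb{R}$. The operator $H$ is called $\epsilon$-bulk-gapped at energy $\lambda$ and scale $L$ if there exist constants $N\in\mathbb{N}$ with $N\ge 2$ and $C<1/N^d$ such that, with $l:=\frac{L+r}{N}+r$, the following implication holds for every $x\in\Gamma$ and every $\psi\in\ell^2(\Gamma;\mathcal{H})$: whenever $$\|(H-\lambda)\psi\|_{B_L(x)}\le\epsilon\,\|\psi\|_{B_L(x)},$$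 then $$\|\psi\|_{\overline{B_l}(x)}^2\le C\,\|\psi\|_{B_L(x)}^2 .$$ *)

theory Defs
  imports "HOL-Analysis.Analysis"
begin

(* Complex inner product spaces.  The inner product is conjugate-linear in the first
   argument and linear in the second. *)

class complex_inner_space = real_normed_vector +
  fixes scaleC :: "complex \<Rightarrow> 'a \<Rightarrow> 'a" (infixr "*\<^sub>C" 75)
    and cinner :: "'a \<Rightarrow> 'a \<Rightarrow> complex"
  assumes scaleC_add_right: "a *\<^sub>C (x + y) = a *\<^sub>C x + a *\<^sub>C y"
    and scaleC_add_left: "(a + b) *\<^sub>C x = a *\<^sub>C x + b *\<^sub>C x"
    and scaleC_scaleC: "a *\<^sub>C (b *\<^sub>C x) = (a * b) *\<^sub>C x"
    and scaleR_scaleC: "scaleR t x = complex_of_real t *\<^sub>C x"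
    and cinner_commute: "cinner x y = cnj (cinner y x)"
    and cinner_add_right: "cinner x (y + z) = cinner x y + cinner x z"
    and cinner_scaleC_right: "cinner x (a *\<^sub>C y) = a * cinner x y"
    and cinner_self: "cinner x x = complex_of_real ((norm x)\<^sup>2)"

class complex_hilbert_space = complex_inner_space + complete_space

(* A vector in l^2(G; h) is represented by its extension by zero to the whole index type;
   operators on l^2(G; h) are functions of which only the values on this set matter. *)

definition l2 :: "'i set \<Rightarrow> ('i \<Rightarrow> 'h::complex_hilbert_space) set" where
  "l2 G = {\<psi>. (\<forall>x. x \<notin> G \<longrightarrow> \<psi> x = 0) \<and> (\<lambda>x. (norm (\<psi> x))\<^sup>2) summable_on G}"

definition l2_inner ::
    "'i set \<Rightarrow> ('i \<Rightarrow> 'h::complex_hilbert_space) \<Rightarrow> ('i \<Rightarrow> 'h) \<Rightarrow> complex" where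
  "l2_inner G \<phi> \<psi> = (\<Sum>\<^sub>\<infinity>x\<in>G. cinner (\<phi> x) (\<psi> x))"

definition l2_norm_on ::
    "'i set \<Rightarrow> 'i set \<Rightarrow> ('i \<Rightarrow> 'h::complex_hilbert_space) \<Rightarrow> real" where
  "l2_norm_on G A \<psi> = sqrt (\<Sum>\<^sub>\<infinity>x\<in>G \<inter> A. (norm (\<psi> x))\<^sup>2)"

definition l2_norm :: "'i set \<Rightarrow> ('i \<Rightarrow> 'h::complex_hilbert_space) \<Rightarrow> real" where
  "l2_norm G \<psi> = l2_norm_on G UNIV \<psi>"

definition bounded_l2_operator ::
    "'i set \<Rightarrow> (('i \<Rightarrow> 'h::complex_hilbert_space) \<Rightarrow> ('i \<Rightarrow> 'h)) \<Rightarrow> bool" where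
  "bounded_l2_operator G T \<longleftrightarrow>
     (\<forall>\<psi>\<in>l2 G. T \<psi> \<in> l2 G) \<and>
     (\<forall>\<phi>\<in>l2 G. \<forall>\<psi>\<in>l2 G. T (\<lambda>x. \<phi> x + \<psi> x) = (\<lambda>x. T \<phi> x + T \<psi> x)) \<and>
     (\<forall>a. \<forall>\<psi>\<in>l2 G. T (\<lambda>x. a *\<^sub>C \<psi> x) = (\<lambda>x. a *\<^sub>C T \<psi> x)) \<and>
     (\<exists>K. \<forall>\<psi>\<in>l2 G. l2_norm G (T \<psi>) \<le> K * l2_norm G \<psi>)"

definition is_l2_adjoint ::
    "'i set \<Rightarrow> (('i \<Rightarrow> 'h::complex_hilbert_space) \<Rightarrow> ('i \<Rightarrow> 'h)) \<Rightarrow>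
     (('i \<Rightarrow> 'h) \<Rightarrow> ('i \<Rightarrow> 'h)) \<Rightarrow> bool" where
  "is_l2_adjoint G T S \<longleftrightarrow>
     (\<forall>\<phi>\<in>l2 G. \<forall>\<psi>\<in>l2 G. l2_inner G (S \<phi>) \<psi> = l2_inner G \<phi> (T \<psi>))"

definition self_adjoint_l2_operator ::
    "'i set \<Rightarrow> (('i \<Rightarrow> 'h::complex_hilbert_space) \<Rightarrow> ('i \<Rightarrow> 'h)) \<Rightarrow> bool" where
  "self_adjoint_l2_operator G T \<longleftrightarrow> is_l2_adjoint G T T"

definition shifted ::
    "(('i \<Rightarrow> 'h::complex_hilbert_space) \<Rightarrow> ('i \<Rightarrow> 'h)) \<Rightarrow> complex \<Rightarrow> ('i \<Rightarrow> 'h) \<Rightarrow> ('i \<Rightarrow> 'h)" where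
  "shifted T z \<psi> = (\<lambda>x. T \<psi> x - z *\<^sub>C \<psi> x)"

definition l2_spectrum ::
    "'i set \<Rightarrow> (('i \<Rightarrow> 'h::complex_hilbert_space) \<Rightarrow> ('i \<Rightarrow> 'h)) \<Rightarrow> complex set" where
  "l2_spectrum G T =
     {z. \<not> (\<exists>S. bounded_l2_operator G S \<and>
              (\<forall>\<psi>\<in>l2 G. S (shifted T z \<psi>) = \<psi> \<and> shifted T z (S \<psi>) = \<psi>))}"

definition open_cube :: "real \<Rightarrow> real ^ 'd \<Rightarrow> (real ^ 'd) set" where
  "open_cube \<rho> x = {y. \<forall>j. x $ j - \<rho> < y $ j \<and> y $ j < x $ j + \<rho>}"

(* H is e-bulk-gapped at energy lam and scale L; r is the covering radius of G. *)

definition bulk_gapped ::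
    "(real ^ 'd) set \<Rightarrow> real \<Rightarrow>
     ((real ^ 'd \<Rightarrow> 'h::complex_hilbert_space) \<Rightarrow> (real ^ 'd \<Rightarrow> 'h)) \<Rightarrow>
     real \<Rightarrow> real \<Rightarrow> real \<Rightarrow> bool" where
  "bulk_gapped G r H e lam L \<longleftrightarrow>
     (\<exists>(N::nat) (C::real). N \<ge> 2 \<and> C < 1 / real N ^ CARD('d) \<and>
       (let l = (L + r) / real N + r in
        \<forall>x\<in>G. \<forall>\<psi>\<in>l2 G.
          l2_norm_on G (open_cube L x) (shifted H (complex_of_real lam) \<psi>)
            \<le> e * l2_norm_on G (open_cube L x) \<psi> \<longrightarrow>
          (l2_norm_on G (closure (open_cube l x)) \<psi>)\<^sup>2
            \<le> C * (l2_norm_on G (open_cube L x) \<psi>)\<^sup>2))"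

end

theory Submission
  imports Defs
begin

text \<open>Let \<open>\<phi> = (H - \<mu>)\<psi>\<close> with \<open>\<eta> = \<epsilon> - \<bar>\<mu> - \<lambda>\<bar> > 0\<close>. On a cube \<open>B\<^sub>L(x)\<close> where the hypothesis of the bulk gap fails,
  the triangle inequality gives \<open>\<eta>\<parallel>\<psi>\<parallel> \<le> \<parallel>\<phi>\<parallel>\<close>; on the others the mass of \<open>\<psi>\<close> in the small cube is at most
  the fraction \<open>C\<close> of its mass in the large one. Centre the cubes at points of \<open>\<Gamma>\<close> within \<open>r\<close> of the
  lattice of spacing \<open>2(L + r)/N\<close>: the small cubes cover space and the large ones overlap at most
  \<open>N\<^sup>d\<close> times, so summation yields \<open>\<parallel>\<psi>\<parallel>\<^sup>2 \<le> N\<^sup>d (C\<parallel>\<psi>\<parallel>\<^sup>2 + \<eta>\<^sup>-\<^sup>2\<parallel>\<phi>\<parallel>\<^sup>2)\<close>. As \<open>C N\<^sup>d < 1\<close>, \<open>H - \<mu>\<close> is bounded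
  below, and being self-adjoint it is invertible.\<close>

section \<open>Square-summable families\<close>

context complex_inner_space
begin

lemma cinner_add_left: "cinner (x + y) z = cinner x z + cinner y z"
  by (metis cinner_commute cinner_add_right complex_cnj_add)

lemma cinner_scaleC_left: "cinner (a *\<^sub>C x) y = cnj a * cinner x y"
  by (metis cinner_commute cinner_scaleC_right complex_cnj_mult)

lemma norm_scaleC: "norm (a *\<^sub>C x) = cmod a * norm x"
proof -
  have "cinner (a *\<^sub>C x) (a *\<^sub>C x) = (a * cnj a) * cinner x x"
    by (simp add: cinner_scaleC_left cinner_scaleC_right)
  also have "a * cnj a = complex_of_real ((cmod a)\<^sup>2)"
    by (rule complex_norm_square [symmetric])
  finally have "complex_of_real ((norm (a *\<^sub>C x))\<^sup>2) = complex_of_real ((cmod a)\<^sup>2 * (norm x)\<^sup>2)"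
    unfolding cinner_self by (simp only: of_real_mult)
  then have "(norm (a *\<^sub>C x))\<^sup>2 = (cmod a * norm x)\<^sup>2"
    by (simp only: of_real_eq_iff power_mult_distrib)
  then show ?thesis
    by (rule power2_eq_imp_eq) auto
qed

text \<open>Polarization. It reduces questions about sums of inner products to sums of squared
  norms, which membership in \<open>l2\<close> controls.\<close>

lemma Re_cinner_polar: "Re (cinner x y) = ((norm (x + y))\<^sup>2 - (norm x)\<^sup>2 - (norm y)\<^sup>2) / 2"
proof -
  have "complex_of_real ((norm (x + y))\<^sup>2) = cinner x x + cinner y y + cinner x y + cnj (cinner x y)"
    unfolding cinner_self [symmetric] cinner_add_left cinner_add_right
    by (simp add: cinner_commute [of y x])
  then have "complex_of_real ((norm (x + y))\<^sup>2) =
      complex_of_real ((norm x)\<^sup>2) + complex_of_real ((norm y)\<^sup>2) + cinner x y + cnj (cinner x y)"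
    by (simp only: cinner_self)
  from arg_cong [OF this, of Re] show ?thesis
    by simp
qed

end

lemma scaleC_minus1: "(- 1) *\<^sub>C x = - (x :: 'a::complex_inner_space)"
  using scaleR_scaleC [of "-1" x] by simp

lemma scaleC_zero_right [simp]: "a *\<^sub>C (0 :: 'a::complex_inner_space) = 0"
  using norm_scaleC [of a "0 :: 'a"] by simp

section \<open>Local and global norms of square-summable families\<close>

lemma l2_norm_on_nonneg [simp]: "0 \<le> l2_norm_on G A \<psi>"
  by (simp add: l2_norm_on_def infsum_nonneg)

lemma l2_norm_nonneg [simp]: "0 \<le> l2_norm G \<psi>"
  by (simp add: l2_norm_def)

lemma l2_norm_on_square: "(l2_norm_on G A \<psi>)\<^sup>2 = (\<Sum>\<^sub>\<infinity>x\<in>G \<inter> A. (norm (\<psi> x))\<^sup>2)"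
  by (simp add: l2_norm_on_def infsum_nonneg)

lemma l2_norm_square: "(l2_norm G \<psi>)\<^sup>2 = (\<Sum>\<^sub>\<infinity>x\<in>G. (norm (\<psi> x))\<^sup>2)"
  by (simp add: l2_norm_def l2_norm_on_square)

lemma l2_summable_on: "\<psi> \<in> l2 G \<Longrightarrow> (\<lambda>x. (norm (\<psi> x))\<^sup>2) summable_on G \<inter> A"
  by (auto simp: l2_def intro: summable_on_subset_banach)

lemma l2_zero_outside: "\<psi> \<in> l2 G \<Longrightarrow> x \<notin> G \<Longrightarrow> \<psi> x = 0"
  by (simp add: l2_def)

lemma zero_in_l2: "(\<lambda>x. 0) \<in> l2 G"
  by (simp add: l2_def)

lemma l2_norm_zero [simp]: "l2_norm G (\<lambda>x. 0) = 0"
  by (simp add: l2_norm_def l2_norm_on_def)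

lemma l2_norm_on_mono:
  assumes "\<psi> \<in> l2 G" "G \<inter> A \<subseteq> B"
  shows "l2_norm_on G A \<psi> \<le> l2_norm_on G B \<psi>"
  unfolding l2_norm_on_def
  by (intro real_sqrt_le_mono infsum_mono2 l2_summable_on assms(1)) (use assms(2) in auto)

lemma L2_set_le_l2_norm_on:
  assumes "\<psi> \<in> l2 G" "finite F" "F \<subseteq> G \<inter> A"
  shows "L2_set (\<lambda>x. norm (\<psi> x)) F \<le> l2_norm_on G A \<psi>"
  unfolding L2_set_def l2_norm_on_def
  by (intro real_sqrt_le_mono finite_sum_le_infsum l2_summable_on assms) auto

lemma norm_le_l2_norm:
  assumes "\<psi> \<in> l2 G"
  shows "norm (\<psi> x) \<le> l2_norm G \<psi>"
proof (cases "x \<in> G")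
  case True
  then show ?thesis
    using L2_set_le_l2_norm_on [OF assms, of "{x}" UNIV] by (simp add: l2_norm_def)
next
  case False
  then show ?thesis
    by (simp add: l2_zero_outside [OF assms])
qed

lemma l2_norm_eq_0_iff:
  assumes "\<psi> \<in> l2 G"
  shows "l2_norm G \<psi> = 0 \<longleftrightarrow> \<psi> = (\<lambda>x. 0)"
proof
  assume "l2_norm G \<psi> = 0"
  then have "norm (\<psi> x) \<le> 0" for x
    using norm_le_l2_norm [OF assms, of x] by simp
  then show "\<psi> = (\<lambda>x. 0)"
    by auto
qed simp

text \<open>Converse of \<open>L2_set_le_l2_norm_on\<close>. The finite partial sums of a
  nonnegative family determine both its summability and its value, so inequalities for the finite
  \<open>L2_set\<close> carry over to infinite sums.\<close>

lemma
  assumes bound: "\<And>F. finite F \<Longrightarrow> F \<subseteq> G \<inter> A \<Longrightarrow> L2_set (\<lambda>x. norm (\<psi> x)) F \<le> b"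
  shows L2_set_bounded_summable: "(\<lambda>x. (norm (\<psi> x))\<^sup>2) summable_on G \<inter> A"
    and L2_set_bounded_norm_le: "l2_norm_on G A \<psi> \<le> b"
proof -
  have b: "0 \<le> b"
    using bound [of "{}"] by simp
  have *: "(\<Sum>x\<in>F. (norm (\<psi> x))\<^sup>2) \<le> b\<^sup>2" if "finite F" "F \<subseteq> G \<inter> A" for F
    using bound [OF that] b unfolding L2_set_def by (simp add: real_sqrt_le_iff sqrt_le_D)
  show **: "(\<lambda>x. (norm (\<psi> x))\<^sup>2) summable_on G \<inter> A"
    by (rule nonneg_bdd_above_summable_on) (use * in \<open>auto intro!: bdd_aboveI2 [where M = "b\<^sup>2"]\<close>)
  show "l2_norm_on G A \<psi> \<le> b"
    unfolding l2_norm_on_def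
    by (intro real_le_lsqrt b infsum_le_finite_sums ** *)
qed

text \<open>Minkowski's inequality on each finite set, followed by passage to the whole of
  \<open>G \<inter> A\<close>. The choice of \<open>A\<close> as the whole space gives closure under
  addition.\<close>

lemma
  assumes "\<phi> \<in> l2 G" "\<psi> \<in> l2 G"
  shows l2_add: "(\<lambda>x. \<phi> x + \<psi> x) \<in> l2 G"
    and l2_norm_on_triangle:
      "l2_norm_on G A (\<lambda>x. \<phi> x + \<psi> x) \<le> l2_norm_on G A \<phi> + l2_norm_on G A \<psi>"
proof -
  have *: "L2_set (\<lambda>x. norm (\<phi> x + \<psi> x)) F \<le> l2_norm_on G A \<phi> + l2_norm_on G A \<psi>"
    if "finite F" "F \<subseteq> G \<inter> A" for F A
  proof -
    have "L2_set (\<lambda>x. norm (\<phi> x + \<psi> x)) F \<le> L2_set (\<lambda>x. norm (\<phi> x) + norm (\<psi> x)) F"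
      by (rule L2_set_mono) (auto intro: norm_triangle_ineq)
    also have "\<dots> \<le> L2_set (\<lambda>x. norm (\<phi> x)) F + L2_set (\<lambda>x. norm (\<psi> x)) F"
      by (rule L2_set_triangle_ineq)
    also have "\<dots> \<le> l2_norm_on G A \<phi> + l2_norm_on G A \<psi>"
      by (intro add_mono L2_set_le_l2_norm_on assms that)
    finally show ?thesis .
  qed
  show "l2_norm_on G A (\<lambda>x. \<phi> x + \<psi> x) \<le> l2_norm_on G A \<phi> + l2_norm_on G A \<psi>"
    by (rule L2_set_bounded_norm_le) (rule *)
  have "(\<lambda>x. (norm (\<phi> x + \<psi> x))\<^sup>2) summable_on G \<inter> UNIV"
    by (rule L2_set_bounded_summable) (rule *)
  then show "(\<lambda>x. \<phi> x + \<psi> x) \<in> l2 G"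
    using assms by (simp add: l2_def)
qed

lemma l2_scaleC: "\<psi> \<in> l2 G \<Longrightarrow> (\<lambda>x. a *\<^sub>C \<psi> x) \<in> l2 G"
  by (simp add: l2_def norm_scaleC power_mult_distrib summable_on_cmult_right)

lemma l2_norm_on_scaleC: "l2_norm_on G A (\<lambda>x. a *\<^sub>C \<psi> x) = cmod a * l2_norm_on G A \<psi>"
  by (simp add: l2_norm_on_def norm_scaleC power_mult_distrib infsum_cmult_right' real_sqrt_mult)

lemma l2_norm_scaleC: "l2_norm G (\<lambda>x. a *\<^sub>C \<psi> x) = cmod a * l2_norm G \<psi>"
  by (simp add: l2_norm_def l2_norm_on_scaleC)

lemma l2_diff:
  assumes "\<phi> \<in> l2 G" "\<psi> \<in> l2 G"
  shows "(\<lambda>x. \<phi> x - \<psi> x) \<in> l2 G"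
  using l2_add [OF assms(1) l2_scaleC [OF assms(2), of "-1"]] by (simp add: scaleC_minus1)

lemma l2_norm_triangle:
  assumes "\<phi> \<in> l2 G" "\<psi> \<in> l2 G"
  shows "l2_norm G (\<lambda>x. \<phi> x + \<psi> x) \<le> l2_norm G \<phi> + l2_norm G \<psi>"
  unfolding l2_norm_def by (rule l2_norm_on_triangle [OF assms])

lemma l2_norm_minus_commute: "l2_norm G (\<lambda>x. \<phi> x - \<psi> x) = l2_norm G (\<lambda>x. \<psi> x - \<phi> x)"
  by (simp add: l2_norm_def l2_norm_on_def norm_minus_commute)

text \<open>The limit is found pointwise, each coordinate being dominated by the norm. The Cauchy
  estimate is then passed to the limit on finite sets, and only afterwards extended to all of
  \<open>G\<close>.\<close>

lemma l2_complete:
  fixes f :: "nat \<Rightarrow> 'i \<Rightarrow> 'h::complex_hilbert_space"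
  assumes mem: "\<And>n. f n \<in> l2 G"
    and cauchy: "\<And>e. e > 0 \<Longrightarrow> \<exists>M. \<forall>m\<ge>M. \<forall>n\<ge>M. l2_norm G (\<lambda>x. f m x - f n x) \<le> e"
  obtains \<psi> where "\<psi> \<in> l2 G" "(\<lambda>n. l2_norm G (\<lambda>x. f n x - \<psi> x)) \<longlonglongrightarrow> 0"
proof -
  have "Cauchy (\<lambda>n. f n x)" for x
  proof (rule CauchyI)
    fix e :: real
    assume "e > 0"
    then obtain M where M: "\<forall>m\<ge>M. \<forall>n\<ge>M. l2_norm G (\<lambda>x. f m x - f n x) \<le> e / 2"
      using cauchy [of "e / 2"] by auto
    have "norm (f m x - f n x) < e" if "m \<ge> M" "n \<ge> M" for m n
    proof -
      have "norm (f m x - f n x) \<le> l2_norm G (\<lambda>x. f m x - f n x)"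
        by (rule norm_le_l2_norm [OF l2_diff [OF mem mem]])
      also have "\<dots> \<le> e / 2"
        using M that by blast
      finally show ?thesis
        using \<open>e > 0\<close> by linarith
    qed
    then show "\<exists>M. \<forall>m\<ge>M. \<forall>n\<ge>M. norm (f m x - f n x) < e"
      by blast
  qed
  then have "\<forall>x. \<exists>l. (\<lambda>n. f n x) \<longlonglongrightarrow> l"
    using Cauchy_convergent_iff convergent_def by blast
  then obtain \<psi> where lim: "\<And>x. (\<lambda>n. f n x) \<longlonglongrightarrow> \<psi> x"
    by metis
  \<comment> \<open>Here \<open>m\<close> and \<open>F\<close> stay fixed while \<open>n\<close>
    tends to infinity; as \<open>F\<close> is finite, pointwise convergence is enough.\<close>
  have close: "L2_set (\<lambda>x. norm (f m x - \<psi> x)) F \<le> e"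
    if "\<forall>m\<ge>M. \<forall>n\<ge>M. l2_norm G (\<lambda>x. f m x - f n x) \<le> e" "m \<ge> M" "finite F" "F \<subseteq> G \<inter> UNIV" for e M m F
  proof (rule LIMSEQ_le_const2)
    show "(\<lambda>n. L2_set (\<lambda>x. norm (f m x - f n x)) F) \<longlonglongrightarrow> L2_set (\<lambda>x. norm (f m x - \<psi> x)) F"
      unfolding L2_set_def by (intro tendsto_intros lim)
    have "L2_set (\<lambda>x. norm (f m x - f n x)) F \<le> e" if "n \<ge> M" for n
      using L2_set_le_l2_norm_on [OF l2_diff [OF mem mem] \<open>finite F\<close> \<open>F \<subseteq> G \<inter> UNIV\<close>] that
        \<open>\<forall>m\<ge>M. \<forall>n\<ge>M. l2_norm G (\<lambda>x. f m x - f n x) \<le> e\<close> \<open>m \<ge> M\<close>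
      unfolding l2_norm_def [symmetric] by (meson order_trans)
    then show "\<exists>N. \<forall>n\<ge>N. L2_set (\<lambda>x. norm (f m x - f n x)) F \<le> e"
      by blast
  qed
  have outside: "\<psi> x = 0" if "x \<notin> G" for x
    using lim [of x] l2_zero_outside [OF mem that] by (simp add: LIMSEQ_const_iff)
  obtain M where M: "\<forall>m\<ge>M. \<forall>n\<ge>M. l2_norm G (\<lambda>x. f m x - f n x) \<le> 1"
    using cauchy [of 1] by auto
  have "(\<lambda>x. (norm (f M x - \<psi> x))\<^sup>2) summable_on G \<inter> UNIV"
    by (rule L2_set_bounded_summable) (rule close [OF M order_refl])
  \<comment> \<open>Membership of \<psi> itself follows by subtracting this difference from
    \<open>f M\<close>.\<close>
  then have "(\<lambda>x. f M x - \<psi> x) \<in> l2 G"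
    using outside l2_zero_outside [OF mem] by (simp add: l2_def)
  from l2_diff [OF mem [of M] this] have "\<psi> \<in> l2 G"
    by simp
  moreover have "(\<lambda>n. l2_norm G (\<lambda>x. f n x - \<psi> x)) \<longlonglongrightarrow> 0"
  proof (rule LIMSEQ_I)
    fix e :: real
    assume "e > 0"
    then obtain M where M: "\<forall>m\<ge>M. \<forall>n\<ge>M. l2_norm G (\<lambda>x. f m x - f n x) \<le> e / 2"
      using cauchy [of "e / 2"] by auto
    have half: "l2_norm G (\<lambda>x. f m x - \<psi> x) \<le> e / 2" if "m \<ge> M" for m
      unfolding l2_norm_def by (rule L2_set_bounded_norm_le) (rule close [OF M that])
    have "l2_norm G (\<lambda>x. f m x - \<psi> x) < e" if "m \<ge> M" for m
      using half [OF that] \<open>e > 0\<close> by linarith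
    then have "\<forall>n\<ge>M. norm (l2_norm G (\<lambda>x. f n x - \<psi> x) - 0) < e"
      by simp
    then show "\<exists>M. \<forall>n\<ge>M. norm (l2_norm G (\<lambda>x. f n x - \<psi> x) - 0) < e"
      by blast
  qed
  ultimately show ?thesis
    using that by blast
qed

section \<open>The inner product on \<open>l2\<close>\<close>

lemma l2_inner_summable:
  assumes "\<phi> \<in> l2 G" "\<psi> \<in> l2 G"
  shows "(\<lambda>x. cinner (\<phi> x) (\<psi> x)) summable_on G"
proof -
  \<comment> \<open>By polarization the real part is half a combination of three summable families
    of squared norms.\<close>
  have Re: "(\<lambda>x. Re (cinner (\<phi> x) (\<psi> x))) summable_on G" if "\<psi> \<in> l2 G" for \<psi>
  proof -
    have "(\<lambda>x. ((norm (\<phi> x + \<psi> x))\<^sup>2 + - (norm (\<phi> x))\<^sup>2 + - (norm (\<psi> x))\<^sup>2) * (1 / 2))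
        summable_on G \<inter> UNIV"
      by (intro summable_on_cmult_left summable_on_add summable_on_uminus [THEN iffD2]
          l2_summable_on l2_add assms(1) that)
    then show ?thesis
      by (simp add: Re_cinner_polar)
  qed
  \<comment> \<open>Multiplying the second argument by \<open>- \<i>\<close> turns imaginary parts
    into real parts, so the case just proved applies again.\<close>
  have Im: "Im (cinner (\<phi> x) (\<psi> x)) = Re (cinner (\<phi> x) ((- \<i>) *\<^sub>C \<psi> x))" for x
    by (simp add: cinner_scaleC_right)
  have "(\<lambda>x. Im (cinner (\<phi> x) (\<psi> x))) summable_on G"
    unfolding Im by (rule Re [OF l2_scaleC [OF assms(2)]])
  then have "(\<lambda>x. of_real (Re (cinner (\<phi> x) (\<psi> x))) + \<i> * of_real (Im (cinner (\<phi> x) (\<psi> x)))) summable_on G"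
    by (intro summable_on_add summable_on_cmult_right summable_on_of_real Re assms(2))
  then show ?thesis
    by (simp flip: complex_eq)
qed

lemma l2_inner_add_left:
  assumes "\<phi> \<in> l2 G" "\<phi>' \<in> l2 G" "\<psi> \<in> l2 G"
  shows "l2_inner G (\<lambda>x. \<phi> x + \<phi>' x) \<psi> = l2_inner G \<phi> \<psi> + l2_inner G \<phi>' \<psi>"
  unfolding l2_inner_def by (simp add: cinner_add_left infsum_add l2_inner_summable assms)

lemma l2_inner_add_right:
  assumes "\<phi> \<in> l2 G" "\<psi> \<in> l2 G" "\<psi>' \<in> l2 G"
  shows "l2_inner G \<phi> (\<lambda>x. \<psi> x + \<psi>' x) = l2_inner G \<phi> \<psi> + l2_inner G \<phi> \<psi>'"
  unfolding l2_inner_def by (simp add: cinner_add_right infsum_add l2_inner_summable assms)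

lemma l2_inner_scaleC_left: "l2_inner G (\<lambda>x. a *\<^sub>C \<phi> x) \<psi> = cnj a * l2_inner G \<phi> \<psi>"
  unfolding l2_inner_def by (simp add: cinner_scaleC_left infsum_cmult_right')

lemma l2_inner_scaleC_right: "l2_inner G \<phi> (\<lambda>x. a *\<^sub>C \<psi> x) = a * l2_inner G \<phi> \<psi>"
  unfolding l2_inner_def by (simp add: cinner_scaleC_right infsum_cmult_right')

lemma l2_inner_self:
  assumes "\<psi> \<in> l2 G"
  shows "l2_inner G \<psi> \<psi> = complex_of_real ((l2_norm G \<psi>)\<^sup>2)"
  using l2_summable_on [OF assms, of UNIV]
  unfolding l2_inner_def cinner_self l2_norm_square
  by (intro infsumI has_sum_of_real has_sum_infsum) simp

lemma l2_norm_add_square: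
  assumes "\<phi> \<in> l2 G" "\<psi> \<in> l2 G"
  shows "(l2_norm G (\<lambda>x. \<phi> x + \<psi> x))\<^sup>2 =
    (l2_norm G \<phi>)\<^sup>2 + 2 * Re (l2_inner G \<phi> \<psi>) + (l2_norm G \<psi>)\<^sup>2"
proof -
  have "(l2_norm G (\<lambda>x. \<phi> x + \<psi> x))\<^sup>2 =
    (\<Sum>\<^sub>\<infinity>x\<in>G. (norm (\<phi> x))\<^sup>2 + 2 * Re (cinner (\<phi> x) (\<psi> x)) + (norm (\<psi> x))\<^sup>2)"
    unfolding l2_norm_square by (intro infsum_cong) (simp add: Re_cinner_polar field_simps)
  also have "\<dots> = (l2_norm G \<phi>)\<^sup>2 + 2 * Re (l2_inner G \<phi> \<psi>) + (l2_norm G \<psi>)\<^sup>2"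
    using l2_summable_on [OF assms(1), of UNIV] l2_summable_on [OF assms(2), of UNIV]
      l2_inner_summable [OF assms]
    unfolding l2_norm_square l2_inner_def
    by (simp add: infsum_add summable_on_add summable_on_cmult_right summable_on_Re
        infsum_cmult_right' infsum_Re)
  finally show ?thesis .
qed

section \<open>Self-adjoint operators bounded below\<close>

lemma scaleC_minus_left: "(- a) *\<^sub>C x = - (a *\<^sub>C (x :: 'a::complex_inner_space))"
  using scaleC_scaleC [of "-1" a x] by (simp add: scaleC_minus1)

lemma scaleC_diff_left: "(a - b) *\<^sub>C x = a *\<^sub>C x - b *\<^sub>C (x :: 'a::complex_inner_space)"
  using scaleC_add_left [of a "- b" x] by (simp add: scaleC_minus_left)

lemma shifted_eq_add: "shifted T z \<psi> = (\<lambda>x. T \<psi> x + (- z) *\<^sub>C \<psi> x)"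
  by (simp add: shifted_def scaleC_minus_left)

section \<open>Bounded operators, their shifts, and surjectivity\<close>

context
  fixes G :: "'i set" and T :: "('i \<Rightarrow> 'h::complex_hilbert_space) \<Rightarrow> ('i \<Rightarrow> 'h)"
  assumes T: "bounded_l2_operator G T"
begin

lemma bounded_l2_operator_mem: "\<psi> \<in> l2 G \<Longrightarrow> T \<psi> \<in> l2 G"
  using T by (simp add: bounded_l2_operator_def)

lemma bounded_l2_operator_add:
  "\<phi> \<in> l2 G \<Longrightarrow> \<psi> \<in> l2 G \<Longrightarrow> T (\<lambda>x. \<phi> x + \<psi> x) = (\<lambda>x. T \<phi> x + T \<psi> x)"
  using T by (simp add: bounded_l2_operator_def)

lemma bounded_l2_operator_scaleC: "\<psi> \<in> l2 G \<Longrightarrow> T (\<lambda>x. a *\<^sub>C \<psi> x) = (\<lambda>x. a *\<^sub>C T \<psi> x)"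
  using T by (simp add: bounded_l2_operator_def)

lemma bounded_l2_operator_diff:
  assumes "\<phi> \<in> l2 G" "\<psi> \<in> l2 G"
  shows "T (\<lambda>x. \<phi> x - \<psi> x) = (\<lambda>x. T \<phi> x - T \<psi> x)"
  using bounded_l2_operator_add [OF assms(1) l2_scaleC [OF assms(2), of "-1"]]
    bounded_l2_operator_scaleC [OF assms(2), of "-1"]
  by (simp add: scaleC_minus1)

lemma bounded_l2_operator_bound:
  obtains K where "K \<ge> 1" "\<And>\<psi>. \<psi> \<in> l2 G \<Longrightarrow> l2_norm G (T \<psi>) \<le> K * l2_norm G \<psi>"
proof -
  obtain K where K: "\<forall>\<psi>\<in>l2 G. l2_norm G (T \<psi>) \<le> K * l2_norm G \<psi>"
    using T unfolding bounded_l2_operator_def by blast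
  have "l2_norm G (T \<psi>) \<le> max K 1 * l2_norm G \<psi>" if "\<psi> \<in> l2 G" for \<psi>
    using K that by (meson order_trans mult_right_mono max.cobounded1 l2_norm_nonneg)
  then show ?thesis
    using that [of "max K 1"] by simp
qed

lemma shifted_mem: "\<psi> \<in> l2 G \<Longrightarrow> shifted T z \<psi> \<in> l2 G"
  unfolding shifted_eq_add by (intro l2_add l2_scaleC bounded_l2_operator_mem)

lemma bounded_l2_operator_shifted: "bounded_l2_operator G (shifted T z)"
  unfolding bounded_l2_operator_def
proof (intro conjI ballI allI)
  obtain K where K: "\<And>\<psi>. \<psi> \<in> l2 G \<Longrightarrow> l2_norm G (T \<psi>) \<le> K * l2_norm G \<psi>"
    using bounded_l2_operator_bound by blast
  have "l2_norm G (shifted T z \<psi>) \<le> (K + cmod z) * l2_norm G \<psi>" if "\<psi> \<in> l2 G" for \<psi>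
  proof -
    have "l2_norm G (shifted T z \<psi>) \<le> l2_norm G (T \<psi>) + l2_norm G (\<lambda>x. (- z) *\<^sub>C \<psi> x)"
      unfolding shifted_eq_add
      by (intro l2_norm_triangle bounded_l2_operator_mem l2_scaleC that)
    also have "\<dots> \<le> K * l2_norm G \<psi> + cmod z * l2_norm G \<psi>"
      using K [OF that] by (simp add: l2_norm_scaleC)
    finally show ?thesis
      by (simp add: algebra_simps)
  qed
  then show "\<exists>K. \<forall>\<psi>\<in>l2 G. l2_norm G (shifted T z \<psi>) \<le> K * l2_norm G \<psi>"
    by blast
qed (simp_all add: shifted_mem, simp_all add: shifted_eq_add bounded_l2_operator_add bounded_l2_operator_scaleC
      scaleC_add_right scaleC_scaleC mult.commute fun_eq_iff)

lemma self_adjoint_shifted: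
  assumes "self_adjoint_l2_operator G T" "z \<in> \<real>"
  shows "self_adjoint_l2_operator G (shifted T z)"
  using assms unfolding self_adjoint_l2_operator_def is_l2_adjoint_def shifted_eq_add
  by (auto simp: l2_inner_add_left l2_inner_add_right l2_inner_scaleC_left l2_inner_scaleC_right
      l2_scaleC bounded_l2_operator_mem Reals_cnj_iff)

text \<open>With \<open>t = 1 / K\<^sup>2\<close>, where \<open>K\<close> bounds the norm of \<open>T\<close>, the operator \<open>1 - t T\<^sup>2\<close> is a strict
  contraction, so that \<open>T\<^sup>2\<close> is onto by fixed point iteration.\<close>

lemma self_adjoint_bounded_below_surj:
  assumes self_adjoint: "self_adjoint_l2_operator G T"
    and c: "c > 0" and below: "\<And>\<psi>. \<psi> \<in> l2 G \<Longrightarrow> c * l2_norm G \<psi> \<le> l2_norm G (T \<psi>)"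
    and \<phi>: "\<phi> \<in> l2 G"
  obtains \<psi> where "\<psi> \<in> l2 G" "T \<psi> = \<phi>"
proof -
  obtain K where K: "K \<ge> 1" "\<And>\<psi>. \<psi> \<in> l2 G \<Longrightarrow> l2_norm G (T \<psi>) \<le> K * l2_norm G \<psi>"
    using bounded_l2_operator_bound by blast
  define t where "t = 1 / K\<^sup>2"
  define A where "A \<psi> = (\<lambda>x. \<psi> x + complex_of_real (- t) *\<^sub>C T (T \<psi>) x)" for \<psi>
  \<comment> \<open>In a nonzero space \<open>c \<le> K\<close>, so the radicand is already
    nonnegative. The maximum with 0 covers the zero space, where \<open>c\<close> may exceed
    \<open>K\<close>.\<close>
  define q where "q = sqrt (max 0 (1 - t * c\<^sup>2))"
  have t: "t > 0" "t * K\<^sup>2 = 1"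
    using K(1) by (auto simp: t_def)
  have q: "0 \<le> q" "q < 1" "1 - t * c\<^sup>2 \<le> q\<^sup>2"
    using t c by (auto simp: q_def)
  note mem = bounded_l2_operator_mem
  have A_mem: "A \<psi> \<in> l2 G" if "\<psi> \<in> l2 G" for \<psi>
    unfolding A_def by (intro l2_add l2_scaleC mem that)
  have A_diff: "A (\<lambda>x. \<psi> x - \<psi>' x) = (\<lambda>x. A \<psi> x - A \<psi>' x)" if "\<psi> \<in> l2 G" "\<psi>' \<in> l2 G" for \<psi> \<psi>'
    unfolding A_def using that
    by (simp add: bounded_l2_operator_diff mem scaleC_minus_left flip: scaleR_scaleC)
       (simp add: algebra_simps)
  have contraction: "l2_norm G (A \<psi>) \<le> q * l2_norm G \<psi>" if \<psi>: "\<psi> \<in> l2 G" for \<psi>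
  proof (rule power2_le_imp_le)
    \<comment> \<open>Self-adjointness identifies the cross term of the expanded square as a
      negative multiple of the squared norm of \<open>T \<psi>\<close>.\<close>
    have "l2_inner G \<psi> (T (T \<psi>)) = l2_inner G (T \<psi>) (T \<psi>)"
      using self_adjoint mem \<psi> unfolding self_adjoint_l2_operator_def is_l2_adjoint_def by simp
    then have "(l2_norm G (A \<psi>))\<^sup>2 =
        (l2_norm G \<psi>)\<^sup>2 - 2 * t * (l2_norm G (T \<psi>))\<^sup>2 + (t * l2_norm G (T (T \<psi>)))\<^sup>2"
      unfolding A_def using \<psi> t
      by (simp add: l2_norm_add_square l2_scaleC mem l2_inner_scaleC_right l2_inner_self
          l2_norm_scaleC del: of_real_power of_real_minus)
    also have "(t * l2_norm G (T (T \<psi>)))\<^sup>2 \<le> (t * (K * l2_norm G (T \<psi>)))\<^sup>2"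
      using K(2) [OF mem [OF \<psi>]] t by (intro power_mono mult_left_mono) auto
    \<comment> \<open>Since \<open>t * K\<^sup>2 = 1\<close>, the quadratic term cancels exactly
      half of the cross term, leaving a net gain of \<open>t\<close> times the squared norm of
      \<open>T \<psi>\<close>.\<close>
    also have "\<dots> = t * (t * K\<^sup>2) * (l2_norm G (T \<psi>))\<^sup>2"
      by (simp add: power2_eq_square)
    also have "\<dots> = t * (l2_norm G (T \<psi>))\<^sup>2"
      by (simp add: t(2))
    also have "(l2_norm G \<psi>)\<^sup>2 - 2 * t * (l2_norm G (T \<psi>))\<^sup>2 + t * (l2_norm G (T \<psi>))\<^sup>2
        = (l2_norm G \<psi>)\<^sup>2 - t * (l2_norm G (T \<psi>))\<^sup>2"
      by simp
    also have "\<dots> \<le> (l2_norm G \<psi>)\<^sup>2 - t * (c * l2_norm G \<psi>)\<^sup>2"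
      using below [OF \<psi>] t(1) c by (intro diff_left_mono mult_left_mono power_mono) auto
    also have "\<dots> = (1 - t * c\<^sup>2) * (l2_norm G \<psi>)\<^sup>2"
      by (simp add: algebra_simps)
    also have "\<dots> \<le> q\<^sup>2 * (l2_norm G \<psi>)\<^sup>2"
      by (intro mult_right_mono q) simp
    finally show "(l2_norm G (A \<psi>))\<^sup>2 \<le> (q * l2_norm G \<psi>)\<^sup>2"
      by (simp add: power_mult_distrib)
  qed (simp add: q)
  \<comment> \<open>Iterates of the affine contraction sending \<psi> to
    \<open>\<phi> + A \<psi>\<close>, started at 0. A fixed point satisfies
    \<open>t T (T \<psi>) = \<phi>\<close>.\<close>
  define f where "f n = ((\<lambda>\<psi> x. \<phi> x + A \<psi> x) ^^ n) (\<lambda>x. 0)" for n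
  have f_0: "f 0 = (\<lambda>x. 0)" and f_Suc: "f (Suc n) = (\<lambda>x. \<phi> x + A (f n) x)" for n
    by (simp_all add: f_def)
  have f_mem: "f n \<in> l2 G" for n
    by (induction n) (simp_all add: f_0 f_Suc zero_in_l2 l2_add \<phi> A_mem)
  \<comment> \<open>The sum of the geometric series with ratio \<open>q\<close>, equivalently the
    fixed point of the scalar recursion that dominates the norms of the iterates.\<close>
  define B where "B = l2_norm G \<phi> / (1 - q)"
  have B: "0 \<le> B" "l2_norm G \<phi> + q * B = B"
    using q by (simp_all add: B_def field_simps)
  have f_bound: "l2_norm G (f n) \<le> B" for n
  proof (induction n)
    case 0
    then show ?case
      using B by (simp add: f_0)
  next
    case (Suc n)
    have "l2_norm G (f (Suc n)) \<le> l2_norm G \<phi> + q * l2_norm G (f n)"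
      unfolding f_Suc
      by (rule order_trans [OF l2_norm_triangle [OF \<phi> A_mem [OF f_mem]]])
         (intro add_left_mono contraction f_mem)
    also have "\<dots> \<le> B"
      using mult_left_mono [OF Suc q(1)] B by linarith
    finally show ?case .
  qed
  have f_diff: "l2_norm G (\<lambda>x. f (n + k) x - f n x) \<le> q ^ n * B" for n k
  proof (induction n)
    case 0
    then show ?case
      using f_bound by (simp add: f_0)
  next
    case (Suc n)
    have "l2_norm G (\<lambda>x. f (Suc n + k) x - f (Suc n) x) = l2_norm G (A (\<lambda>x. f (n + k) x - f n x))"
      by (simp add: f_Suc A_diff f_mem)
    also have "\<dots> \<le> q * l2_norm G (\<lambda>x. f (n + k) x - f n x)"
      by (intro contraction l2_diff f_mem)
    also have "\<dots> \<le> q ^ Suc n * B"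
      using mult_left_mono [OF Suc q(1)] by (simp add: mult.assoc)
    finally show ?case .
  qed
  have f_dist: "l2_norm G (\<lambda>x. f m x - f n x) \<le> q ^ M * B" if "M \<le> m" "M \<le> n" for m n M
  proof -
    have "l2_norm G (\<lambda>x. f m x - f n x) \<le> q ^ min m n * B"
      using f_diff [of n "m - n"] f_diff [of m "n - m"] l2_norm_minus_commute [of G "f m" "f n"]
      by (cases "n \<le> m") (auto simp: min_def)
    also have "\<dots> \<le> q ^ M * B"
      using that q B by (intro mult_right_mono power_decreasing) auto
    finally show ?thesis .
  qed
  have "(\<lambda>M. q ^ M * B) \<longlonglongrightarrow> 0"
    using q by (intro tendsto_mult_left_zero LIMSEQ_realpow_zero)
  then have small: "\<forall>\<^sub>F M in sequentially. q ^ M * B < e" if "e > 0" for e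
    using that by (rule order_tendstoD)
  have cauchy: "\<exists>M. \<forall>m\<ge>M. \<forall>n\<ge>M. l2_norm G (\<lambda>x. f m x - f n x) \<le> e" if "e > 0" for e
  proof -
    obtain M where M: "q ^ M * B < e"
      using small [OF \<open>e > 0\<close>] by (auto simp: eventually_sequentially)
    have "l2_norm G (\<lambda>x. f m x - f n x) \<le> e" if "M \<le> m" "M \<le> n" for m n
      using f_dist [OF that] M by linarith
    then show ?thesis
      by blast
  qed
  obtain \<psi> where \<psi>: "\<psi> \<in> l2 G" and lim: "(\<lambda>n. l2_norm G (\<lambda>x. f n x - \<psi> x)) \<longlonglongrightarrow> 0"
    using l2_complete [of f G, OF f_mem cauchy] by blast
  \<comment> \<open>The defect of \<psi> in the fixed point equation. Inserting \<open>f n\<close>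
    and \<open>f (Suc n)\<close> bounds its norm by errors that tend to 0, so it vanishes.\<close>
  define \<eta> where "\<eta> = (\<lambda>x. (\<phi> x + A \<psi> x) - \<psi> x)"
  have \<eta>: "\<eta> \<in> l2 G"
    unfolding \<eta>_def by (intro l2_diff l2_add A_mem \<phi> \<psi>)
  have "l2_norm G \<eta> \<le> q * l2_norm G (\<lambda>x. f n x - \<psi> x) + l2_norm G (\<lambda>x. f (Suc n) x - \<psi> x)" for n
  proof -
    have "\<eta> = (\<lambda>x. A (\<lambda>x. \<psi> x - f n x) x + (f (Suc n) x - \<psi> x))"
      by (simp add: \<eta>_def A_diff \<psi> f_mem f_Suc fun_eq_iff)
    then have "l2_norm G \<eta> \<le> l2_norm G (A (\<lambda>x. \<psi> x - f n x)) + l2_norm G (\<lambda>x. f (Suc n) x - \<psi> x)"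
      by (simp only:) (intro l2_norm_triangle A_mem l2_diff \<psi> f_mem)
    also have "l2_norm G (A (\<lambda>x. \<psi> x - f n x)) \<le> q * l2_norm G (\<lambda>x. f n x - \<psi> x)"
      using contraction [OF l2_diff [OF \<psi> f_mem [of n]]]
      by (simp add: l2_norm_minus_commute [of G \<psi>])
    finally show ?thesis
      by simp
  qed
  moreover have "(\<lambda>n. q * l2_norm G (\<lambda>x. f n x - \<psi> x) + l2_norm G (\<lambda>x. f (Suc n) x - \<psi> x)) \<longlonglongrightarrow> q * 0 + 0"
    by (intro tendsto_intros lim LIMSEQ_Suc [OF lim])
  ultimately have "l2_norm G \<eta> \<le> q * 0 + 0"
    by (meson LIMSEQ_le_const)
  then have "\<eta> = (\<lambda>x. 0)"
    using l2_norm_eq_0_iff [OF \<eta>] l2_norm_nonneg [of G \<eta>] by auto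
  \<comment> \<open>Pulling one factor \<open>T\<close> out exhibits \<open>t T \<psi>\<close> as
    the required preimage under \<open>T\<close>.\<close>
  then have "\<phi> = (\<lambda>x. complex_of_real t *\<^sub>C T (T \<psi>) x)"
    by (auto simp: \<eta>_def A_def fun_eq_iff scaleC_minus_left)
  also have "\<dots> = T (\<lambda>x. complex_of_real t *\<^sub>C T \<psi> x)"
    by (simp add: bounded_l2_operator_scaleC mem \<psi>)
  finally show ?thesis
    using that l2_scaleC [OF mem [OF \<psi>]] by metis
qed

end

text \<open>The lower bound yields injectivity and the bound \<open>1 / c\<close> for the inverse;
  surjectivity comes from the fixed point argument applied to the shift, which is self-adjoint
  because \<open>z\<close> is real.\<close>

lemma bounded_below_not_in_l2_spectrum:
  assumes H: "bounded_l2_operator G H" "self_adjoint_l2_operator G H" and z: "z \<in> \<real>"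
    and c: "c > 0"
    and below: "\<And>\<psi>. \<psi> \<in> l2 G \<Longrightarrow> c * l2_norm G \<psi> \<le> l2_norm G (shifted H z \<psi>)"
  shows "z \<notin> l2_spectrum G H"
proof -
  let ?T = "shifted H z"
  define S where "S = inv_into (l2 G) ?T"
  note T = bounded_l2_operator_shifted [OF H(1), of z]
  note mem = bounded_l2_operator_mem [OF T]
  have inj: "inj_on ?T (l2 G)"
  proof (rule inj_onI)
    fix \<phi> \<psi>
    assume *: "\<phi> \<in> l2 G" "\<psi> \<in> l2 G" "?T \<phi> = ?T \<psi>"
    have "c * l2_norm G (\<lambda>x. \<phi> x - \<psi> x) \<le> l2_norm G (\<lambda>x. 0 :: 'b)"
      using below [OF l2_diff [OF *(1,2)]] * by (simp add: bounded_l2_operator_diff [OF T])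
    then have "c * l2_norm G (\<lambda>x. \<phi> x - \<psi> x) \<le> 0"
      by simp
    then have "l2_norm G (\<lambda>x. \<phi> x - \<psi> x) = 0"
      using c l2_norm_nonneg [of G "\<lambda>x. \<phi> x - \<psi> x"] by (simp add: mult_le_0_iff)
    then show "\<phi> = \<psi>"
      using l2_norm_eq_0_iff [OF l2_diff [OF *(1,2)]] by (simp add: fun_eq_iff)
  qed
  have onto: "\<phi> \<in> ?T ` l2 G" if "\<phi> \<in> l2 G" for \<phi>
    using self_adjoint_bounded_below_surj [OF T self_adjoint_shifted [OF H z] c below that]
    by blast
  have S_mem: "S \<phi> \<in> l2 G" and T_S: "?T (S \<phi>) = \<phi>" if "\<phi> \<in> l2 G" for \<phi>
    unfolding S_def using inv_into_into [OF onto [OF that]] f_inv_into_f [OF onto [OF that]] by simp_all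
  \<comment> \<open>Uniqueness of preimages; the linearity of \<open>S\<close> is read off from that
    of the shifted operator in this way.\<close>
  have S_eq: "S \<phi> = \<psi>" if "\<psi> \<in> l2 G" "?T \<psi> = \<phi>" for \<phi> \<psi>
    using inv_into_f_f [OF inj that(1)] by (simp add: S_def that(2))
  have "bounded_l2_operator G S"
    unfolding bounded_l2_operator_def
  proof (intro conjI ballI allI exI)
    fix \<phi> \<psi> :: "'a \<Rightarrow> 'b" and a
    assume \<phi>: "\<phi> \<in> l2 G"
    show "S \<phi> \<in> l2 G"
      by (rule S_mem [OF \<phi>])
    show "S (\<lambda>x. a *\<^sub>C \<phi> x) = (\<lambda>x. a *\<^sub>C S \<phi> x)"
      by (rule S_eq) (simp_all add: l2_scaleC S_mem T_S \<phi> bounded_l2_operator_scaleC [OF T])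
    show "l2_norm G (S \<phi>) \<le> (1 / c) * l2_norm G \<phi>"
      using below [OF S_mem [OF \<phi>]] c by (simp add: T_S \<phi> field_simps)
    assume \<psi>: "\<psi> \<in> l2 G"
    show "S (\<lambda>x. \<phi> x + \<psi> x) = (\<lambda>x. S \<phi> x + S \<psi> x)"
      by (rule S_eq) (simp_all add: l2_add S_mem T_S \<phi> \<psi> bounded_l2_operator_add [OF T])
  qed
  then show ?thesis
    unfolding l2_spectrum_def using S_eq T_S by blast
qed

section \<open>Coverings by cubes\<close>

lemma has_sum_sum:
  fixes f :: "'k \<Rightarrow> 'i \<Rightarrow> 'b::topological_comm_monoid_add"
  assumes "finite K" "\<And>k. k \<in> K \<Longrightarrow> (f k has_sum s k) G"
  shows "((\<lambda>x. \<Sum>k\<in>K. f k x) has_sum (\<Sum>k\<in>K. s k)) G"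
  using assms by (induction K rule: finite_induct) (simp_all add: has_sum_add)

text \<open>The pieces \<open>A k\<close> count every point at least once and the pieces
  \<open>B k\<close> at most \<open>M\<close> times, so adding the local estimates costs only the
  factor \<open>M\<close>. There may be infinitely many indices; the sum is therefore first
  restricted to a finite set of points, for which finitely many pieces suffice.\<close>

lemma l2_norm_covering_bound:
  fixes \<psi> \<phi> :: "'i \<Rightarrow> 'h::complex_hilbert_space"
  assumes \<psi>: "\<psi> \<in> l2 G" and \<phi>: "\<phi> \<in> l2 G"
    and cover: "\<And>x. x \<in> G \<Longrightarrow> \<exists>k. x \<in> A k"
    and mult: "\<And>x. x \<in> G \<Longrightarrow> finite {k. x \<in> B k} \<and> card {k. x \<in> B k} \<le> M"
    and C: "0 \<le> C" and D: "0 \<le> D"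
    and loc: "\<And>k. (l2_norm_on G (A k) \<psi>)\<^sup>2 \<le>
      C * (l2_norm_on G (B k) \<psi>)\<^sup>2 + D * (l2_norm_on G (B k) \<phi>)\<^sup>2"
  shows "(l2_norm G \<psi>)\<^sup>2 \<le> real M * (C * (l2_norm G \<psi>)\<^sup>2 + D * (l2_norm G \<phi>)\<^sup>2)"
proof -
  have overlap: "(\<Sum>k\<in>K. (l2_norm_on G (B k) \<xi>)\<^sup>2) \<le> real M * (l2_norm G \<xi>)\<^sup>2"
    if K: "finite K" and \<xi>: "\<xi> \<in> l2 G" for K and \<xi> :: "'i \<Rightarrow> 'h"
  proof -
    let ?f = "\<lambda>x. (norm (\<xi> x))\<^sup>2"
    \<comment> \<open>Extending by zero puts all local sums on the common index set
      \<open>G\<close>, so that the sums over \<open>k\<close> and \<open>x\<close> can be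
      exchanged.\<close>
    have ind: "(\<lambda>x. if x \<in> B k then ?f x else 0) summable_on G" for k
      by (rule summable_on_cong_neutral [THEN iffD1, OF _ _ _ l2_summable_on [OF \<xi>, of "B k"]]) auto
    have sum: "((\<lambda>x. \<Sum>k\<in>K. if x \<in> B k then ?f x else 0) has_sum
        (\<Sum>k\<in>K. \<Sum>\<^sub>\<infinity>x\<in>G. if x \<in> B k then ?f x else 0)) G"
      using K by (rule has_sum_sum) (intro has_sum_infsum ind)
    have "(\<Sum>k\<in>K. (l2_norm_on G (B k) \<xi>)\<^sup>2) = (\<Sum>k\<in>K. \<Sum>\<^sub>\<infinity>x\<in>G. if x \<in> B k then ?f x else 0)"
      unfolding l2_norm_on_square by (intro sum.cong refl infsum_cong_neutral) auto
    also have "\<dots> = (\<Sum>\<^sub>\<infinity>x\<in>G. \<Sum>k\<in>K. if x \<in> B k then ?f x else 0)"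
      using sum by (rule infsumI [symmetric])
    also have "\<dots> \<le> (\<Sum>\<^sub>\<infinity>x\<in>G. real M * ?f x)"
    proof (rule infsum_mono)
      show "(\<lambda>x. \<Sum>k\<in>K. if x \<in> B k then ?f x else 0) summable_on G"
        using sum by (rule has_sum_imp_summable)
      show "(\<lambda>x. real M * ?f x) summable_on G"
        using l2_summable_on [OF \<xi>, of UNIV] by (simp add: summable_on_cmult_right)
      fix x
      assume x: "x \<in> G"
      have "card {k \<in> K. x \<in> B k} \<le> card {k. x \<in> B k}"
        using mult [OF x] by (intro card_mono) auto
      then have "card {k \<in> K. x \<in> B k} \<le> M"
        using mult [OF x] by simp
      then show "(\<Sum>k\<in>K. if x \<in> B k then ?f x else 0) \<le> real M * ?f x"
        using K by (simp add: sum.If_cases Int_def mult_right_mono)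
    qed
    also have "\<dots> = real M * (l2_norm G \<xi>)\<^sup>2"
      by (simp add: l2_norm_square infsum_cmult_right')
    finally show ?thesis .
  qed
  let ?b = "real M * (C * (l2_norm G \<psi>)\<^sup>2 + D * (l2_norm G \<phi>)\<^sup>2)"
  obtain k where k: "\<And>x. x \<in> G \<Longrightarrow> x \<in> A (k x)"
    using cover by metis
  have "(\<Sum>\<^sub>\<infinity>x\<in>G. (norm (\<psi> x))\<^sup>2) \<le> ?b"
  proof (rule infsum_le_finite_sums)
    show "(\<lambda>x. (norm (\<psi> x))\<^sup>2) summable_on G"
      using l2_summable_on [OF \<psi>, of UNIV] by simp
    fix F
    assume F: "finite F" "F \<subseteq> G"
    \<comment> \<open>One chosen piece per point: grouping \<open>F\<close> by its choice counts
      each point exactly once even where the \<open>A k\<close> overlap.\<close>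
    have "(\<Sum>x\<in>F. (norm (\<psi> x))\<^sup>2) = (\<Sum>j\<in>k ` F. \<Sum>x | x \<in> F \<and> k x = j. (norm (\<psi> x))\<^sup>2)"
      using F(1) by (rule sum.image_gen)
    also have "\<dots> \<le> (\<Sum>j\<in>k ` F. (l2_norm_on G (A j) \<psi>)\<^sup>2)"
      unfolding l2_norm_on_square
      by (intro sum_mono finite_sum_le_infsum l2_summable_on \<psi>) (use F k in \<open>auto, metis subsetD\<close>)
    also have "\<dots> \<le> (\<Sum>j\<in>k ` F. C * (l2_norm_on G (B j) \<psi>)\<^sup>2 + D * (l2_norm_on G (B j) \<phi>)\<^sup>2)"
      by (intro sum_mono loc)
    also have "\<dots> = C * (\<Sum>j\<in>k ` F. (l2_norm_on G (B j) \<psi>)\<^sup>2) + D * (\<Sum>j\<in>k ` F. (l2_norm_on G (B j) \<phi>)\<^sup>2)"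
      by (simp add: sum.distrib sum_distrib_left)
    also have "\<dots> \<le> C * (real M * (l2_norm G \<psi>)\<^sup>2) + D * (real M * (l2_norm G \<phi>)\<^sup>2)"
      using F by (intro add_mono mult_left_mono overlap C D \<psi> \<phi>) auto
    also have "\<dots> = ?b"
      by (simp add: algebra_simps)
    finally show "(\<Sum>x\<in>F. (norm (\<psi> x))\<^sup>2) \<le> ?b" .
  qed
  then show ?thesis
    by (simp add: l2_norm_square [of G \<psi>])
qed

section \<open>Lattices and the geometry of cubes\<close>

lemma
  fixes a :: real
  shows finite_ints_in_open_interval: "finite {n::int. a < n \<and> n < a + real N}" (is "finite ?I")
    and card_ints_in_open_interval: "card {n::int. a < n \<and> n < a + real N} \<le> N"
proof -
  \<comment> \<open>Openness at both ends matters: a closed interval of this length can contain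
    \<open>N + 1\<close> integers, and the overlap bound \<open>N ^ d\<close> matching the
    hypothesis on \<open>C\<close> would be lost.\<close>
  have sub: "?I \<subseteq> {\<lfloor>a\<rfloor> + 1..\<lfloor>a\<rfloor> + int N}"
  proof
    fix n
    assume "n \<in> ?I"
    then have "a < n" "n < a + real N"
      by auto
    then have "\<lfloor>a\<rfloor> < n" "n < \<lfloor>a\<rfloor> + int N + 1"
      by linarith+
    then show "n \<in> {\<lfloor>a\<rfloor> + 1..\<lfloor>a\<rfloor> + int N}"
      by auto
  qed
  then show "finite ?I"
    by (rule finite_subset) simp
  show "card ?I \<le> N"
    using card_mono [OF _ sub] by simp
qed

definition lattice_point :: "real \<Rightarrow> ('d \<Rightarrow> int) \<Rightarrow> real ^ 'd" where
  "lattice_point s k = (\<chi> j. s * of_int (k j))"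

lemma lattice_point_nth [simp]: "lattice_point s k $ j = s * of_int (k j)"
  by (simp add: lattice_point_def)

text \<open>The condition on \<open>k\<close> decouples: each \<open>k j\<close> must lie in an open
  interval of length \<open>N\<close> centred at \<open>y $ j / s\<close>, which leaves at most
  \<open>N\<close> values per coordinate.\<close>

lemma
  fixes y :: "real ^ 'd"
  assumes s: "s > 0"
  shows finite_lattice_cubes_containing:
      "finite {k. y \<in> open_cube (real N * s / 2) (lattice_point s k)}" (is "finite ?K")
    and card_lattice_cubes_containing:
      "card {k. y \<in> open_cube (real N * s / 2) (lattice_point s k)} \<le> N ^ CARD('d)"
proof -
  let ?a = "\<lambda>j. y $ j / s - real N / 2"
  let ?I = "\<lambda>j. {n::int. ?a j < n \<and> n < ?a j + real N}"
  have sub: "?K \<subseteq> PiE UNIV ?I"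
    using s by (auto simp: open_cube_def field_simps)
  have fin: "finite (PiE UNIV ?I)"
    by (intro finite_PiE finite_ints_in_open_interval) auto
  show "finite ?K"
    using sub fin by (rule finite_subset)
  have "card ?K \<le> (\<Prod>j\<in>(UNIV :: 'd set). card (?I j))"
    using card_mono [OF fin sub] by (simp add: card_PiE)
  also have "\<dots> \<le> (\<Prod>j\<in>(UNIV :: 'd set). N)"
    by (intro prod_mono conjI card_ints_in_open_interval) simp
  finally show "card ?K \<le> N ^ CARD('d)"
    by simp
qed

definition closed_cube :: "real \<Rightarrow> real ^ 'd \<Rightarrow> (real ^ 'd) set" where
  "closed_cube \<rho> x = {y. \<forall>j. \<bar>y $ j - x $ j\<bar> \<le> \<rho>}"

text \<open>Positivity of the radius is essential: at radius 0 the open cube is empty, whereas the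
  closed one is a point.\<close>

lemma closure_open_cube:
  assumes "\<rho> > 0"
  shows "closure (open_cube \<rho> x) = closed_cube \<rho> x"
proof -
  have "open_cube \<rho> x = box (x - (\<chi> j. \<rho>)) (x + (\<chi> j. \<rho>))"
    by (auto simp: open_cube_def mem_box_cart)
  moreover have "box (x - (\<chi> j. \<rho>)) (x + (\<chi> j. \<rho>)) \<noteq> {}"
    using assms by (auto simp: mem_box_cart intro!: ex_in_conv [THEN iffD1] exI [of _ x])
  ultimately have "closure (open_cube \<rho> x) = cbox (x - (\<chi> j. \<rho>)) (x + (\<chi> j. \<rho>))"
    by (simp add: closure_box)
  also have "\<dots> = closed_cube \<rho> x"
    by (auto simp: closed_cube_def mem_box_cart abs_le_iff algebra_simps)
  finally show ?thesis .
qed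

text \<open>Compares a large cube centred in \<open>G\<close> with one centred at a nearby lattice
  point, for counting overlaps. With \<sigma> equal to \<open>r\<close> this is the source of
  \<open>L + r\<close> in the definition of \<open>l\<close>.\<close>

lemma open_cube_mono:
  assumes "y \<in> closed_cube \<sigma> x"
  shows "open_cube \<rho> y \<subseteq> open_cube (\<rho> + \<sigma>) x"
proof
  fix z
  assume z: "z \<in> open_cube \<rho> y"
  have "x $ j - (\<rho> + \<sigma>) < z $ j \<and> z $ j < x $ j + (\<rho> + \<sigma>)" for j
  proof -
    have "\<bar>y $ j - x $ j\<bar> \<le> \<sigma>" "y $ j - \<rho> < z $ j" "z $ j < y $ j + \<rho>"
      using assms z by (simp_all add: closed_cube_def open_cube_def)
    then show ?thesis
      by linarith
  qed
  then show "z \<in> open_cube (\<rho> + \<sigma>) x"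
    by (simp add: open_cube_def)
qed

text \<open>Serves to fit a small lattice cube into a cube about a nearby point of \<open>G\<close>.
  With \<sigma> equal to \<open>r\<close> it accounts for the final \<open>+ r\<close> in
  \<open>l\<close>.\<close>

lemma closed_cube_mono:
  assumes "y \<in> closed_cube \<sigma> x"
  shows "closed_cube \<rho> x \<subseteq> closed_cube (\<rho> + \<sigma>) y"
proof
  fix z
  assume z: "z \<in> closed_cube \<rho> x"
  have "\<bar>z $ j - y $ j\<bar> \<le> \<rho> + \<sigma>" for j
  proof -
    have "\<bar>y $ j - x $ j\<bar> \<le> \<sigma>" "\<bar>z $ j - x $ j\<bar> \<le> \<rho>"
      using assms z by (simp_all add: closed_cube_def)
    then show ?thesis
      by linarith
  qed
  then show "z \<in> closed_cube (\<rho> + \<sigma>) y"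
    by (simp add: closed_cube_def)
qed

lemma closed_cube_subset_open_cube:
  assumes "\<rho> < \<sigma>"
  shows "closed_cube \<rho> x \<subseteq> open_cube \<sigma> x"
proof
  fix z
  assume z: "z \<in> closed_cube \<rho> x"
  have "x $ j - \<sigma> < z $ j \<and> z $ j < x $ j + \<sigma>" for j
  proof -
    have "\<bar>z $ j - x $ j\<bar> \<le> \<rho>"
      using z by (simp add: closed_cube_def)
    then show ?thesis
      using assms by linarith
  qed
  then show "z \<in> open_cube \<sigma> x"
    by (simp add: open_cube_def)
qed

lemma infnorm_le_imp_closed_cube: "infnorm (y - x) \<le> \<rho> \<Longrightarrow> x \<in> closed_cube \<rho> y"
  using component_le_infnorm_cart [of "y - x"]
  by (auto simp: closed_cube_def abs_minus_commute intro: order_trans)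

text \<open>Rounding each rescaled coordinate to the nearest integer gives a lattice point at
  distance at most \<open>s / 2\<close>.\<close>

lemma lattice_cubes_cover:
  assumes s: "s > 0"
  shows "\<exists>k. y \<in> closed_cube (s / 2) (lattice_point s k)"
proof
  have "\<bar>y $ j - s * of_int (round (y $ j / s))\<bar> \<le> s / 2" for j
  proof -
    have "y $ j - s * of_int (round (y $ j / s)) = - s * (of_int (round (y $ j / s)) - y $ j / s)"
      using s by (simp add: field_simps)
    then have "\<bar>y $ j - s * of_int (round (y $ j / s))\<bar> = s * \<bar>of_int (round (y $ j / s)) - y $ j / s\<bar>"
      using s by (simp add: abs_mult)
    also have "\<dots> \<le> s * (1 / 2)"
      using s by (intro mult_left_mono of_int_round_abs_le) auto
    finally show ?thesis
      by simp
  qed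
  then show "y \<in> closed_cube (s / 2) (lattice_point s (\<lambda>j. round (y $ j / s)))"
    by (simp add: closed_cube_def)
qed

section \<open>Bulk gaps\<close>

text \<open>\<open>(H - lam) \<psi>\<close> equals \<open>\<phi> + (\<mu> - lam) \<psi>\<close>. If
  the second alternative fails, \<phi> has norm below \<open>e - \<bar>\<mu> - lam\<bar>\<close>
  times that of \<psi> on \<open>B\<close>, and the two contributions add up to at most
  \<open>e\<close> times it.\<close>

lemma bulk_gapped_dichotomy:
  fixes G :: "(real ^ 'd) set"
    and H :: "(real ^ 'd \<Rightarrow> 'h::complex_hilbert_space) \<Rightarrow> (real ^ 'd \<Rightarrow> 'h)"
  assumes H: "bounded_l2_operator G H" and \<psi>: "\<psi> \<in> l2 G" and \<mu>: "\<bar>\<mu> - lam\<bar> < e"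
  defines "\<phi> \<equiv> shifted H (complex_of_real \<mu>) \<psi>"
  shows "l2_norm_on G B (shifted H (complex_of_real lam) \<psi>) \<le> e * l2_norm_on G B \<psi> \<or>
    (l2_norm_on G B \<psi>)\<^sup>2 \<le> (1 / (e - \<bar>\<mu> - lam\<bar>)\<^sup>2) * (l2_norm_on G B \<phi>)\<^sup>2"
proof (rule disjCI)
  define \<eta> where "\<eta> = e - \<bar>\<mu> - lam\<bar>"
  have \<eta>: "\<eta> > 0"
    using \<mu> by (simp add: \<eta>_def)
  assume "\<not> (l2_norm_on G B \<psi>)\<^sup>2 \<le> (1 / (e - \<bar>\<mu> - lam\<bar>)\<^sup>2) * (l2_norm_on G B \<phi>)\<^sup>2"
  then have "\<not> (l2_norm_on G B \<psi>)\<^sup>2 \<le> (1 / \<eta>\<^sup>2) * (l2_norm_on G B \<phi>)\<^sup>2"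
    by (simp add: \<eta>_def)
  then have "(l2_norm_on G B \<phi>)\<^sup>2 < (\<eta> * l2_norm_on G B \<psi>)\<^sup>2"
    using \<eta> by (simp add: power_mult_distrib field_simps)
  then have "l2_norm_on G B \<phi> < \<eta> * l2_norm_on G B \<psi>"
    by (rule power_less_imp_less_base) (use \<eta> in simp)
  moreover have "shifted H (complex_of_real lam) \<psi> = (\<lambda>x. \<phi> x + complex_of_real (\<mu> - lam) *\<^sub>C \<psi> x)"
    by (simp add: \<phi>_def shifted_def scaleC_diff_left)
  then have "l2_norm_on G B (shifted H (complex_of_real lam) \<psi>) \<le>
      l2_norm_on G B \<phi> + \<bar>\<mu> - lam\<bar> * l2_norm_on G B \<psi>"
    using l2_norm_on_triangle [OF shifted_mem [OF H \<psi>, of "complex_of_real \<mu>"]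
        l2_scaleC [OF \<psi>, of "complex_of_real (\<mu> - lam)"], of B]
    by (simp only: \<phi>_def l2_norm_on_scaleC norm_of_real)
  ultimately show "l2_norm_on G B (shifted H (complex_of_real lam) \<psi>) \<le> e * l2_norm_on G B \<psi>"
    by (simp add: \<eta>_def left_diff_distrib)
qed

text \<open>The sets \<open>B k\<close> need only lie inside the lattice cubes. This allows both
  cubes centred off the lattice and empty sets, as the two applications require.\<close>

lemma lattice_covering_bound:
  fixes G :: "(real ^ 'd) set" and B :: "('d \<Rightarrow> int) \<Rightarrow> (real ^ 'd) set"
    and \<psi> \<phi> :: "real ^ 'd \<Rightarrow> 'h::complex_hilbert_space"
  assumes "s > 0" "\<psi> \<in> l2 G" "\<phi> \<in> l2 G" "0 \<le> C" "0 \<le> D"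
    and B: "\<And>k. B k \<subseteq> open_cube (real N * s / 2) (lattice_point s k)"
    and loc: "\<And>k. (l2_norm_on G (closed_cube (s / 2) (lattice_point s k)) \<psi>)\<^sup>2 \<le>
      C * (l2_norm_on G (B k) \<psi>)\<^sup>2 + D * (l2_norm_on G (B k) \<phi>)\<^sup>2"
  shows "(l2_norm G \<psi>)\<^sup>2 \<le>
    real (N ^ CARD('d)) * (C * (l2_norm G \<psi>)\<^sup>2 + D * (l2_norm G \<phi>)\<^sup>2)"
proof (rule l2_norm_covering_bound
    [where A = "\<lambda>k. closed_cube (s / 2) (lattice_point s k)" and B = B])
  fix x :: "real ^ 'd"
  show "\<exists>k. x \<in> closed_cube (s / 2) (lattice_point s k)"
    by (rule lattice_cubes_cover [OF assms(1)])
  have sub: "{k. x \<in> B k} \<subseteq> {k. x \<in> open_cube (real N * s / 2) (lattice_point s k)}"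
    using B by blast
  note fin = finite_lattice_cubes_containing [OF assms(1), of x N]
  show "finite {k. x \<in> B k} \<and> card {k. x \<in> B k} \<le> N ^ CARD('d)"
    using finite_subset [OF sub fin] card_mono [OF fin sub]
      card_lattice_cubes_containing [OF assms(1), of x N] by linarith
qed (use assms in auto)

text \<open>Because \<open>M * C' < 1\<close>, the \<psi> term on the right of the covering estimate
  can be absorbed on the left. If \<open>l < L\<close>, then \<open>M\<close> is
  \<open>N ^ d\<close> and \<open>C'\<close> is \<open>max C 0\<close>; otherwise they are
  \<open>4 ^ d\<close> and 0.\<close>

lemma bulk_gapped_bounded_below:
  fixes G :: "(real ^ 'd) set"
    and H :: "(real ^ 'd \<Rightarrow> 'h::complex_hilbert_space) \<Rightarrow> (real ^ 'd \<Rightarrow> 'h)"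
  assumes r: "r > 0" and dense: "\<forall>y. \<exists>x\<in>G. infnorm (y - x) \<le> r"
    and H: "bounded_l2_operator G H"
    and L: "L > 0" and gapped: "bulk_gapped G r H e lam L"
    and \<mu>: "\<bar>\<mu> - lam\<bar> < e"
  obtains c where "c > 0"
    "\<And>\<psi>. \<psi> \<in> l2 G \<Longrightarrow> c * l2_norm G \<psi> \<le> l2_norm G (shifted H (complex_of_real \<mu>) \<psi>)"
proof -
  let ?\<phi> = "shifted H (complex_of_real \<mu>)"
  define D where "D = 1 / (e - \<bar>\<mu> - lam\<bar>)\<^sup>2"
  have D: "D > 0"
    using \<mu> by (simp add: D_def)
  obtain N :: nat and C :: real where N: "N \<ge> 2" and C: "C < 1 / real N ^ CARD('d)"
    and gap: "\<And>x \<psi>. x \<in> G \<Longrightarrow> \<psi> \<in> l2 G \<Longrightarrow>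
      l2_norm_on G (open_cube L x) (shifted H (complex_of_real lam) \<psi>)
        \<le> e * l2_norm_on G (open_cube L x) \<psi> \<Longrightarrow>
      (l2_norm_on G (closure (open_cube ((L + r) / real N + r) x)) \<psi>)\<^sup>2
        \<le> C * (l2_norm_on G (open_cube L x) \<psi>)\<^sup>2"
    using gapped unfolding bulk_gapped_def Let_def by blast
  define l where "l = (L + r) / real N + r"
  have l: "l > 0"
    using N L r by (simp add: l_def add_pos_pos)
  have local_bound: "(l2_norm_on G (closed_cube l x) \<psi>)\<^sup>2 \<le> C * (l2_norm_on G (open_cube L x) \<psi>)\<^sup>2 \<or>
      (l2_norm_on G (open_cube L x) \<psi>)\<^sup>2 \<le> D * (l2_norm_on G (open_cube L x) (?\<phi> \<psi>))\<^sup>2"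
    if "x \<in> G" "\<psi> \<in> l2 G" for x \<psi>
    using bulk_gapped_dichotomy [OF H that(2) \<mu>, of "open_cube L x"] gap [OF that]
    unfolding D_def l_def [symmetric] closure_open_cube [OF l] by blast
  obtain M :: nat and C' D' :: real where *: "M > 0" "real M * C' < 1" "D' > 0"
    "\<And>\<psi>. \<psi> \<in> l2 G \<Longrightarrow>
      (l2_norm G \<psi>)\<^sup>2 \<le> real M * (C' * (l2_norm G \<psi>)\<^sup>2 + D' * (l2_norm G (?\<phi> \<psi>))\<^sup>2)"
  proof (cases "l < L")
    case True
    \<comment> \<open>Both radii then fit: \<open>s / 2\<close> enlarged by \<open>r\<close> is
      \<open>l\<close>, and \<open>L\<close> enlarged by \<open>r\<close> is
      \<open>N * s / 2\<close>, the radius with overlap number \<open>N ^ d\<close>.\<close>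
    define s where "s = 2 * (L + r) / real N"
    have s: "s > 0" "real N * s / 2 = L + r" "s / 2 + r = l"
      using N L r by (simp_all add: s_def l_def field_simps)
    have "\<forall>k. \<exists>x\<in>G. x \<in> closed_cube r (lattice_point s k)"
      using dense infnorm_le_imp_closed_cube by blast
    then obtain x where x: "\<And>k. x k \<in> G" "\<And>k. x k \<in> closed_cube r (lattice_point s k)"
      by metis
    have "(l2_norm G \<psi>)\<^sup>2 \<le> real (N ^ CARD('d)) *
        (max C 0 * (l2_norm G \<psi>)\<^sup>2 + D * (l2_norm G (?\<phi> \<psi>))\<^sup>2)" if \<psi>: "\<psi> \<in> l2 G" for \<psi>
    proof (rule lattice_covering_bound [where B = "\<lambda>k. open_cube L (x k)", OF s(1) \<psi> shifted_mem [OF H \<psi>]])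
      fix k
      let ?A = "closed_cube (s / 2) (lattice_point s k)" and ?B = "open_cube L (x k)"
      show "?B \<subseteq> open_cube (real N * s / 2) (lattice_point s k)"
        unfolding s(2) by (rule open_cube_mono [OF x(2)])
      have "?A \<subseteq> closed_cube l (x k)"
        using closed_cube_mono [OF x(2), of "s / 2" k] by (simp only: s(3))
      then have A: "(l2_norm_on G ?A \<psi>)\<^sup>2 \<le> (l2_norm_on G (closed_cube l (x k)) \<psi>)\<^sup>2"
        by (intro power_mono l2_norm_on_mono \<psi>) auto
      \<comment> \<open>This is where \<open>l < L\<close> enters: in the second alternative the
        bound is on the large cube and must be passed to the small one.\<close>
      have B: "(l2_norm_on G (closed_cube l (x k)) \<psi>)\<^sup>2 \<le> (l2_norm_on G ?B \<psi>)\<^sup>2"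
        using closed_cube_subset_open_cube [OF True, of "x k"]
        by (intro power_mono l2_norm_on_mono \<psi>) auto
      \<comment> \<open>\<open>C\<close> may be negative, while the covering estimate asks for a
        nonnegative constant.\<close>
      have "C * (l2_norm_on G ?B \<psi>)\<^sup>2 \<le> max C 0 * (l2_norm_on G ?B \<psi>)\<^sup>2"
        by (intro mult_right_mono) auto
      moreover have "0 \<le> max C 0 * (l2_norm_on G ?B \<psi>)\<^sup>2" "0 \<le> D * (l2_norm_on G ?B (?\<phi> \<psi>))\<^sup>2"
        using D by simp_all
      ultimately show "(l2_norm_on G ?A \<psi>)\<^sup>2 \<le>
          max C 0 * (l2_norm_on G ?B \<psi>)\<^sup>2 + D * (l2_norm_on G ?B (?\<phi> \<psi>))\<^sup>2"
        using local_bound [OF x(1) [of k] \<psi>] A B by linarith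
    qed (use D in auto)
    moreover have "real (N ^ CARD('d)) * max C 0 < 1"
      using C N by (simp add: max_def field_simps)
    ultimately show ?thesis
      using that [of "N ^ CARD('d)" "max C 0" D] N D by simp
  next
    case False
    text \<open>Here the bulk gap forces \<open>\<psi>\<close> to vanish on every cube where its hypothesis holds, so that a
      covering by smaller cubes with overlap number \<open>4 ^ d\<close> suffices.\<close>
    have outer: "(l2_norm_on G (open_cube L x) \<psi>)\<^sup>2 \<le> D * (l2_norm_on G (open_cube L x) (?\<phi> \<psi>))\<^sup>2"
      if x: "x \<in> G" and \<psi>: "\<psi> \<in> l2 G" for x \<psi>
    proof -
      let ?n = "(l2_norm_on G (open_cube L x) \<psi>)\<^sup>2"
      have "open_cube L x \<subseteq> closed_cube l x"
        using closure_subset [of "open_cube L x"] closed_cube_mono [of x "l - L" x L] False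
        unfolding closure_open_cube [OF L] by (simp add: closed_cube_def)
      then have "?n \<le> (l2_norm_on G (closed_cube l x) \<psi>)\<^sup>2"
        by (intro power_mono l2_norm_on_mono \<psi>) auto
      moreover have "1 / real N ^ CARD('d) \<le> 1"
        using one_le_power [of "real N" "CARD('d)"] N by simp
      then have "C < 1"
        using C by linarith
      then have "?n \<le> 0" if "?n \<le> C * ?n"
      proof -
        have "(1 - C) * ?n \<le> 0"
          using that by (simp add: left_diff_distrib)
        then show ?thesis
          using \<open>C < 1\<close> by (simp add: mult_le_0_iff)
      qed
      moreover have "0 \<le> D * (l2_norm_on G (open_cube L x) (?\<phi> \<psi>))\<^sup>2"
        using D by simp
      ultimately show ?thesis
        using local_bound [OF x \<psi>] by linarith
    qed
    \<comment> \<open>The value solves \<open>4 * s / 2 = L + s / 2\<close>. Centres within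
      \<open>s / 2\<close> of lattice points put each lattice cube into a closed cube of radius
      \<open>s\<close> about its centre, so \<open>s < L\<close> is required; 4 is the least overlap
      number that permits it.\<close>
    define s where "s = 2 * L / 3"
    have s: "s > 0" "real 4 * s / 2 = L + s / 2" "s < L"
      using L by (simp_all add: s_def)
    \<comment> \<open>Here \<open>r\<close> can exceed \<open>s / 2\<close>, so a lattice cube may
      contain no point of \<open>G\<close>. Such a cube carries no mass and is assigned the empty
      set.\<close>
    define P where "P k \<longleftrightarrow> (\<exists>x\<in>G. x \<in> closed_cube (s / 2) (lattice_point s k))" for k :: "'d \<Rightarrow> int"
    have "\<forall>k. \<exists>x. P k \<longrightarrow> x \<in> G \<and> x \<in> closed_cube (s / 2) (lattice_point s k)"
      by (auto simp: P_def)
    then obtain x where x: "\<And>k. P k \<Longrightarrow> x k \<in> G" "\<And>k. P k \<Longrightarrow> x k \<in> closed_cube (s / 2) (lattice_point s k)"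
      by metis
    have "(l2_norm G \<psi>)\<^sup>2 \<le> real (4 ^ CARD('d)) * (0 * (l2_norm G \<psi>)\<^sup>2 + D * (l2_norm G (?\<phi> \<psi>))\<^sup>2)"
      if \<psi>: "\<psi> \<in> l2 G" for \<psi>
    proof (rule lattice_covering_bound [where B = "\<lambda>k. if P k then open_cube L (x k) else {}",
          OF s(1) \<psi> shifted_mem [OF H \<psi>]])
      fix k
      let ?A = "closed_cube (s / 2) (lattice_point s k)" and ?B = "if P k then open_cube L (x k) else {}"
      show "?B \<subseteq> open_cube (real 4 * s / 2) (lattice_point s k)"
        unfolding s(2) using open_cube_mono [OF x(2), of k L] by simp
      show "(l2_norm_on G ?A \<psi>)\<^sup>2 \<le> 0 * (l2_norm_on G ?B \<psi>)\<^sup>2 + D * (l2_norm_on G ?B (?\<phi> \<psi>))\<^sup>2"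
      proof (cases "P k")
        case True
        have "?A \<subseteq> open_cube L (x k)"
          using closed_cube_mono [OF x(2) [OF True], of "s / 2"] closed_cube_subset_open_cube [OF s(3), of "x k"]
          by simp
        then have "(l2_norm_on G ?A \<psi>)\<^sup>2 \<le> (l2_norm_on G (open_cube L (x k)) \<psi>)\<^sup>2"
          by (intro power_mono l2_norm_on_mono \<psi>) auto
        from order_trans [OF this outer [OF x(1) [OF True] \<psi>]] True show ?thesis
          by simp
      next
        case False
        then have "G \<inter> ?A = {}"
          by (auto simp: P_def)
        then show ?thesis
          using D by (simp add: l2_norm_on_def)
      qed
    qed (use D in auto)
    then show ?thesis
      using that [of "4 ^ CARD('d)" 0 D] D by simp
  qed
  \<comment> \<open>After absorption the squared norms compare with this quotient as factor; its
    root is the lower bound.\<close>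
  define c where "c = sqrt ((1 - real M * C') / (real M * D'))"
  show ?thesis
  proof (rule that [of c])
    show "c > 0"
      using * by (simp add: c_def)
    fix \<psi> :: "real ^ 'd \<Rightarrow> 'h"
    assume "\<psi> \<in> l2 G"
    then have "(1 - real M * C') * (l2_norm G \<psi>)\<^sup>2 \<le> (real M * D') * (l2_norm G (?\<phi> \<psi>))\<^sup>2"
      using *(4) by (simp add: algebra_simps)
    then have "(c * l2_norm G \<psi>)\<^sup>2 \<le> (l2_norm G (?\<phi> \<psi>))\<^sup>2"
      using *(1-3) by (simp add: c_def power_mult_distrib pos_divide_le_eq mult.commute)
    then show "c * l2_norm G \<psi> \<le> l2_norm G (?\<phi> \<psi>)"
      by (rule power2_le_imp_le) simp
  qed
qed

theorem theorem1:
  fixes \<Gamma> :: "(real ^ 'd) set"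
    and H :: "(real ^ 'd \<Rightarrow> 'h::complex_hilbert_space) \<Rightarrow> (real ^ 'd \<Rightarrow> 'h)"
    and r \<epsilon> lam :: real
  assumes "countable \<Gamma>"
    and "r > 0"
    and "\<forall>y. \<exists>x\<in>\<Gamma>. infnorm (y - x) \<le> r"
    and "separable_space (euclidean :: 'h topology)"
    and "bounded_l2_operator \<Gamma> H"
    and "self_adjoint_l2_operator \<Gamma> H"
    and "\<epsilon> > 0"
    and "\<exists>L>0. bulk_gapped \<Gamma> r H \<epsilon> lam L"
  shows "l2_spectrum \<Gamma> H \<inter> complex_of_real ` {lam - \<epsilon> <..< lam + \<epsilon>} = {}"
proof -
  obtain L where L: "L > 0" "bulk_gapped \<Gamma> r H \<epsilon> lam L"
    using assms(8) by blast
  have "complex_of_real \<mu> \<notin> l2_spectrum \<Gamma> H" if \<mu>: "\<bar>\<mu> - lam\<bar> < \<epsilon>" for \<mu>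
  proof -
    obtain c where "c > 0"
      "\<And>\<psi>. \<psi> \<in> l2 \<Gamma> \<Longrightarrow> c * l2_norm \<Gamma> \<psi> \<le> l2_norm \<Gamma> (shifted H (complex_of_real \<mu>) \<psi>)"
      using bulk_gapped_bounded_below [OF assms(2,3,5) L \<mu>] by blast
    then show ?thesis
      by (intro bounded_below_not_in_l2_spectrum [OF assms(5,6)]) auto
  qed
  then show ?thesis
    by (auto simp: abs_less_iff)
qed

end
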